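(* Let $M$ be a paving matroid. Then White's conjecture is true for $M$, i.e., for every positive integer $n$ and every two ordered $n$-tuples $(B_1,\ldots,B_n)$ and $(B'_1,\ldots,B'_n)$ of bases of $M$ with equal multi-set union $B_1\uplus\cdots\uplus B_n=B'_1\uplus\cdots\uplus B'_n$, there exists an exchange sequence in $M$ from $(B_1,\ldots,B_n)$ to $(B'_1,\ldots,B'_n)$.
   Context: Matroids are on finite ground sets. A matroid $M$ of rank $r$ is paving if every circuit of $M$ has size $r$ or $r+1$ (equivalently, every subset of the ground set of size $\le r-1$ is independent). Symmetric exchange: given bases $A,B$ of a matroid $N$, a pair $(A',B')$ is obtained from $(A,B)$ by a symmetric exchange (in $N$) if there are $a\in A\setminus B$ and $b\in B\setminus A$ with $A'=(A\cup\{b\})\setminus\{a\}$, $B'=(B\cup\{a\})\setminus\{b\}$, and $A',B'$ are both bases of $N$. Exchange sequence: an exchange sequence in $N$ (of length $\ell\ge 0$) from $(B_1,\ldots,B_n)$ to $(B'_1,\ldots,B'_n)$ is a sequence $(B_1^{(0)},\ldots,B_n^{(0)})=(B_1,\ldots,B_n),\ldots,(B_1^{(\ell)},\ldots,B_n^{(\ell)})=(B'_1,\ldots,B'_n)$ of $n$-tuples of bases of $N$ such that for each $0<t\le\ell$ there are indices $i\ne j$ for which $(B_i^{(t)},B_j^{(t)})$ is obtained from $(B_i^{(t-1)},B_j^{(t-1)})$ by a symmetric exchange in $N$, and $B_k^{(t)}=B_k^{(t-1)}$ for all $k\neq i,j$. *)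

theory Defs
  imports "HOL-Library.Multiset"
begin

locale matroid =
  fixes E :: "'a set" and indep :: "'a set \<Rightarrow> bool"
  assumes finite_ground: "finite E"
    and indep_subset_ground: "indep X \<Longrightarrow> X \<subseteq> E"
    and indep_empty: "indep {}"
    and indep_subset: "indep X \<Longrightarrow> Y \<subseteq> X \<Longrightarrow> indep Y"
    and indep_augment:
      "indep X \<Longrightarrow> indep Y \<Longrightarrow> card X < card Y \<Longrightarrow> \<exists>y \<in> Y - X. indep (insert y X)"
begin

definition basis :: "'a set \<Rightarrow> bool" where
  "basis B \<longleftrightarrow> indep B \<and> (\<forall>X. indep X \<and> B \<subseteq> X \<longrightarrow> X = B)"

definition circuit :: "'a set \<Rightarrow> bool" where
  "circuit C \<longleftrightarrow> C \<subseteq> E \<and> \<not> indep C \<and> (\<forall>X. X \<subset> C \<longrightarrow> indep X)"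

definition rank :: nat where
  "rank = Max (card ` {X. indep X})"

definition paving :: bool where
  "paving \<longleftrightarrow> (\<forall>C. circuit C \<longrightarrow> card C = rank \<or> card C = rank + 1)"

definition symmetric_exchange :: "'a set \<Rightarrow> 'a set \<Rightarrow> 'a set \<Rightarrow> 'a set \<Rightarrow> bool" where
  "symmetric_exchange A B A' B' \<longleftrightarrow>
     basis A \<and> basis B \<and> basis A' \<and> basis B' \<and>
     (\<exists>a \<in> A - B. \<exists>b \<in> B - A. A' = (A \<union> {b}) - {a} \<and> B' = (B \<union> {a}) - {b})"

text \<open>Ordered \<open>n\<close>-tuples are lists of length \<open>n\<close>, with positions counted from 0.\<close>

definition basis_tuple :: "nat \<Rightarrow> 'a set list \<Rightarrow> bool" where
  "basis_tuple n Bs \<longleftrightarrow> length Bs = n \<and> (\<forall>i < n. basis (Bs ! i))"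

definition exchange_step :: "nat \<Rightarrow> 'a set list \<Rightarrow> 'a set list \<Rightarrow> bool" where
  "exchange_step n Bs Bs' \<longleftrightarrow>
     (\<exists>i < n. \<exists>j < n. i \<noteq> j \<and> symmetric_exchange (Bs ! i) (Bs ! j) (Bs' ! i) (Bs' ! j) \<and>
        (\<forall>k < n. k \<noteq> i \<and> k \<noteq> j \<longrightarrow> Bs' ! k = Bs ! k))"

text \<open>A sequence of length \<open>l\<close> is the list of its \<open>l + 1\<close> tuples, so a singleton list is the
  sequence of length 0.\<close>

definition exchange_sequence ::
    "nat \<Rightarrow> 'a set list list \<Rightarrow> 'a set list \<Rightarrow> 'a set list \<Rightarrow> bool" where
  "exchange_sequence n S Bs Bs' \<longleftrightarrow>
     S \<noteq> [] \<and> hd S = Bs \<and> last S = Bs' \<and>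
     (\<forall>T \<in> set S. basis_tuple n T) \<and>
     (\<forall>t. 0 < t \<and> t < length S \<longrightarrow> exchange_step n (S ! (t - 1)) (S ! t))"

end

text \<open>\<open>mset_set\<close> sends infinite sets to the empty multiset; bases are finite, being subsets of
  the finite ground set.\<close>

definition multiset_union :: "'a set list \<Rightarrow> 'a multiset" where
  "multiset_union Bs = (\<Sum>B\<leftarrow>Bs. mset_set B)"

end

theory Submission
  imports Defs
begin

text \<open>The proof changes only the first tuple, until its head \<open>A\<close> is the head \<open>D\<close> of the second one;
  the tails are then treated by induction.  So it is enough to show that exchanges can increase
  \<open>card (A \<inter> D)\<close> as long as \<open>A \<noteq> D\<close> (\<open>can_approach_head\<close>).

  In a paving matroid any set of one element less than a basis spans each hyperplane that contains
  it.  Hence an element \<open>x\<close> outside a basis \<open>A\<close> can replace all elements of \<open>A\<close> with at most one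
  exception (\<open>blocked_element_unique\<close>).  Exchanges are rarely impossible, and where they are, the
  obstruction is a hyperplane about which much is known.

  Choose \<open>d \<in> D - A\<close> and \<open>e \<in> A - D\<close> such that \<open>d\<close> can replace \<open>e\<close> in \<open>A\<close>.  Since both tuples use
  each element equally often, one can arrange that some later member \<open>B\<close> contains \<open>d\<close> but not \<open>e\<close>.
  The exchange of \<open>e\<close> and \<open>d\<close> between \<open>A\<close> and \<open>B\<close> fails only if \<open>e\<close> lies in the hyperplane \<open>H\<close>
  spanned by \<open>B - {d}\<close>.  There are two remedies.

  If some later member has at least two elements outside \<open>H\<close>, then it can give \<open>B\<close> one of them
  for an element other than \<open>d\<close> (\<open>trade_outside_hyperplane\<close>), after which \<open>e\<close> and \<open>d\<close> can be
  exchanged.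

  Otherwise all later members meet \<open>H\<close> as much as a basis can, and counting incidences with \<open>H\<close>
  gives \<open>d' \<in> D - A\<close> inside \<open>H\<close> and \<open>e' \<in> A - D\<close> outside.  One may assume that \<open>d'\<close> is in \<open>B\<close>
  as well.  If none of the four exchanges of \<open>e\<close>, \<open>e'\<close> for \<open>d\<close>, \<open>d'\<close> works, then each of them is blocked
  on exactly one side, in a crossed pattern, and two successive exchanges through a further
  element of \<open>B\<close> still gain one element of \<open>D\<close> for \<open>A\<close> (\<open>crossed_pair_exchange\<close>).\<close>

section \<open>Bases and hyperplanes\<close>

context matroid
begin

lemma indep_finite: "indep X \<Longrightarrow> finite X"
  using finite_ground finite_subset indep_subset_ground by blast

lemma rank_properties:
  shows indep_card_le_rank: "indep X \<Longrightarrow> card X \<le> rank"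
    and indep_attains_rank: "\<exists>X. indep X \<and> card X = rank"
proof -
  have fin: "finite (card ` {X. indep X})"
    by (rule finite_imageI, rule finite_subset[of _ "Pow E"])
      (use indep_subset_ground finite_ground in auto)
  show "indep X \<Longrightarrow> card X \<le> rank"
    unfolding rank_def using fin by (intro Max_ge) auto
  have "rank \<in> card ` {X. indep X}"
    unfolding rank_def using fin indep_empty by (intro Max_in) auto
  then show "\<exists>X. indep X \<and> card X = rank" by auto
qed

lemma basis_iff_card: "basis B \<longleftrightarrow> indep B \<and> card B = rank"
proof
  assume B: "basis B"
  then have ind: "indep B" by (simp add: basis_def)
  obtain X where X: "indep X" "card X = rank" using indep_attains_rank by blast
  have "\<not> card B < card X"
  proof
    assume "card B < card X"
    then obtain y where "y \<in> X - B" "indep (insert y B)"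
      using indep_augment[OF ind X(1)] by blast
    with B show False unfolding basis_def by blast
  qed
  with X indep_card_le_rank[OF ind] ind show "indep B \<and> card B = rank" by simp
next
  assume B: "indep B \<and> card B = rank"
  have "X = B" if "indep X" "B \<subseteq> X" for X
    using card_seteq[OF indep_finite[OF that(1)] that(2)] B indep_card_le_rank[OF that(1)] by simp
  with B show "basis B" by (simp add: basis_def)
qed

lemma basis_finite: "basis B \<Longrightarrow> finite B"
  and basis_subset_ground: "basis B \<Longrightarrow> B \<subseteq> E"
  and basis_card: "basis B \<Longrightarrow> card B = rank"
  using indep_finite indep_subset_ground by (auto simp: basis_iff_card)

lemma symmetric_exchangeI:
  assumes "basis A" "basis B" "a \<in> A - B" "b \<in> B - A"
    and "basis (insert b (A - {a}))" "basis (insert a (B - {b}))"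
  shows "symmetric_exchange A B (insert b (A - {a})) (insert a (B - {b}))"
proof -
  have "insert b (A - {a}) = (A \<union> {b}) - {a}" "insert a (B - {b}) = (B \<union> {a}) - {b}"
    using assms(3,4) by auto
  with assms show ?thesis unfolding symmetric_exchange_def by blast
qed

lemma small_sets_indep:
  assumes paving and X: "X \<subseteq> E" "card X < rank"
  shows "indep X"
proof (rule ccontr)
  assume dep: "\<not> indep X"
  have finX: "finite X" using X(1) finite_ground finite_subset by blast
  obtain C where C: "C \<subseteq> X" "\<not> indep C" and min: "\<And>Y. Y \<subseteq> C \<Longrightarrow> \<not> indep Y \<Longrightarrow> Y = C"
    using finite_has_minimal2[of "{Y. Y \<subseteq> X \<and> \<not> indep Y}" X] finX dep
    by (auto; metis subset_trans)
  have "circuit C" unfolding circuit_def using C X min by blast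
  with assms(1) have "rank \<le> card C" unfolding paving_def by fastforce
  with card_mono[OF finX C(1)] X(2) show False by simp
qed

text \<open>On a set \<open>U\<close> of one element less than a basis, and hence independent in the paving case,
  this is the hyperplane spanned by \<open>U\<close>.\<close>

definition hyperplane :: "'a set \<Rightarrow> 'a set" where
  "hyperplane U = {x \<in> E. \<not> basis (insert x U)}"

definition near_basis :: "'a set \<Rightarrow> bool" where
  "near_basis U \<longleftrightarrow> U \<subseteq> E \<and> Suc (card U) = rank"

lemma near_basis_remove: "basis B \<Longrightarrow> b \<in> B \<Longrightarrow> near_basis (B - {b})"
  unfolding near_basis_def
  by (metis Diff_subset basis_card basis_finite basis_subset_ground card.remove subset_trans)

lemma near_basis_exchange:
  assumes "near_basis U" "x \<in> E" "x \<notin> U" "u \<in> U"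
  shows "near_basis (insert x (U - {u}))"
proof -
  have "finite U" using assms(1) finite_ground finite_subset unfolding near_basis_def by blast
  then have "card (insert x (U - {u})) = card U"
    using assms(3,4) by (simp add: card_Suc_Diff1 del: card_Diff_insert)
  then show ?thesis using assms unfolding near_basis_def by auto
qed

lemma subset_hyperplane:
  assumes "near_basis U"
  shows "U \<subseteq> hyperplane U"
proof
  fix x assume "x \<in> U"
  then have "insert x U = U" by blast
  with assms \<open>x \<in> U\<close> show "x \<in> hyperplane U"
    unfolding hyperplane_def near_basis_def using basis_card by force
qed

end

section \<open>Paving matroids\<close>

locale paving_matroid = matroid +
  assumes is_paving: paving
begin

lemma near_basis_indep: "near_basis U \<Longrightarrow> indep U"
  unfolding near_basis_def using small_sets_indep[OF is_paving] by auto

lemma no_basis_in_hyperplane: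
  assumes U: "near_basis U" and S: "S \<subseteq> hyperplane U"
  shows "\<not> basis S"
proof
  assume "basis S"
  then have "indep S" "card U < card S"
    using U by (auto simp: basis_iff_card near_basis_def)
  then obtain y where y: "y \<in> S - U" "indep (insert y U)"
    using indep_augment[OF near_basis_indep[OF U]] by blast
  then have "card (insert y U) = rank"
    using U indep_finite[OF near_basis_indep[OF U]] by (auto simp: near_basis_def)
  with y S show False by (auto simp: hyperplane_def basis_iff_card)
qed

text \<open>This is where paving is used: every set of the right size inside a hyperplane is
  independent, and so spans it.  Two hyperplanes therefore share fewer elements than it takes to
  span one of them.\<close>

lemma hyperplane_eqI:
  assumes U: "near_basis U" and V: "near_basis V" and VU: "V \<subseteq> hyperplane U"
  shows "hyperplane V = hyperplane U"
proof -
  have sub: "hyperplane U \<subseteq> hyperplane V"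
  proof
    fix x assume x: "x \<in> hyperplane U"
    then have "\<not> basis (insert x V)" using no_basis_in_hyperplane[OF U] VU by simp
    with x show "x \<in> hyperplane V" by (simp add: hyperplane_def)
  qed
  have "hyperplane V \<subseteq> hyperplane U"
  proof
    fix x assume x: "x \<in> hyperplane V"
    then have "\<not> basis (insert x U)"
      using no_basis_in_hyperplane[OF V] sub subset_hyperplane[OF U] by auto
    with x show "x \<in> hyperplane U" by (simp add: hyperplane_def)
  qed
  with sub show ?thesis by blast
qed

lemma hyperplanes_eq_if_common:
  assumes "near_basis U" "near_basis V" "near_basis W" "W \<subseteq> hyperplane U" "W \<subseteq> hyperplane V"
  shows "hyperplane U = hyperplane V"
  using hyperplane_eqI assms by metis

lemma basis_not_in_own_hyperplane: "basis B \<Longrightarrow> b \<in> B \<Longrightarrow> b \<notin> hyperplane (B - {b})"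
  by (simp add: hyperplane_def insert_absorb)

text \<open>The fundamental circuit of \<open>x\<close> in \<open>A\<close> misses at most one element of \<open>A\<close>, because circuits
  are as large as bases.\<close>

lemma blocked_element_unique:
  assumes A: "basis A" and a: "a \<in> A" "a' \<in> A" "a \<noteq> a'" and x: "x \<in> E" "x \<notin> A"
    and blocked: "\<not> basis (insert x (A - {a}))"
  shows "basis (insert x (A - {a'}))"
proof (rule ccontr)
  assume blocked': "\<not> basis (insert x (A - {a'}))"
  have nb: "near_basis (A - {a})" "near_basis (A - {a'})"
    using near_basis_remove A a by auto
  have "near_basis (insert x (A - {a} - {a'}))"
    using near_basis_exchange[OF nb(1)] x a by simp
  moreover have "insert x (A - {a} - {a'}) \<subseteq> hyperplane (A - {a})"
    using subset_hyperplane[OF nb(1)] x blocked by (auto simp: hyperplane_def)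
  moreover have "insert x (A - {a} - {a'}) \<subseteq> hyperplane (A - {a'})"
    using subset_hyperplane[OF nb(2)] x blocked' by (auto simp: hyperplane_def)
  ultimately have "hyperplane (A - {a}) = hyperplane (A - {a'})"
    using hyperplanes_eq_if_common nb by blast
  with subset_hyperplane[OF nb(2)] basis_not_in_own_hyperplane[OF A a(1)] a show False by blast
qed

text \<open>Elements of \<open>B\<close> outside the hyperplane \<open>H\<close> of \<open>A - {a}\<close> are admissible for \<open>A\<close>, and all but
  at most one of them for \<open>B\<close>.  If there is only one, then the others span \<open>H\<close>, which misses \<open>a\<close>, so
  that this one is admissible as well.\<close>

lemma symmetric_exchange_property:
  assumes A: "basis A" and B: "basis B" and a: "a \<in> A - B"
  obtains b where "b \<in> B - A" "basis (insert b (A - {a}))" "basis (insert a (B - {b}))"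
proof -
  define H where "H = hyperplane (A - {a})"
  have nbA: "near_basis (A - {a})" using near_basis_remove A a by blast
  have AH: "A - {a} \<subseteq> H" using subset_hyperplane[OF nbA] by (simp add: H_def)
  have aH: "a \<notin> H" using basis_not_in_own_hyperplane A a by (simp add: H_def)
  have aE: "a \<in> E" using A a basis_subset_ground by blast
  have ok: "c \<in> B - A \<and> basis (insert c (A - {a}))" if "c \<in> B" "c \<notin> H" for c
    using that a AH basis_subset_ground[OF B] unfolding H_def hyperplane_def by auto
  obtain b where b: "b \<in> B" "b \<notin> H"
    using no_basis_in_hyperplane[OF nbA, of B] B by (auto simp: H_def)
  show thesis
  proof (cases "basis (insert a (B - {b}))")
    case True
    then show ?thesis using that ok b by blast
  next
    case False
    have nbB: "near_basis (B - {b})" using near_basis_remove B b by blast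
    have "\<not> B - {b} \<subseteq> H"
    proof
      assume "B - {b} \<subseteq> H"
      then have "hyperplane (B - {b}) = H" using hyperplane_eqI[OF nbA nbB] by (simp add: H_def)
      with False aH aE show False by (auto simp: hyperplane_def)
    qed
    then obtain c where c: "c \<in> B" "c \<noteq> b" "c \<notin> H" by blast
    then have "basis (insert a (B - {c}))"
      using blocked_element_unique[OF B b(1) c(1)] False a aE by blast
    then show ?thesis using that ok c by blast
  qed
qed

lemma basis_exchange_into:
  assumes A: "basis A" and D: "basis D" and d: "d \<in> D - A"
  obtains e where "e \<in> A - D" "basis (insert d (A - {e}))"
  using symmetric_exchange_property[OF D A d] by blast

section \<open>Removing obstructions to an exchange\<close>

text \<open>Let \<open>H\<close> be the hyperplane that contains \<open>B - {d}\<close> and \<open>e\<close>, so that \<open>e\<close> cannot replace \<open>d\<close>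
  in \<open>B\<close>.  Trading an element \<open>f \<noteq> d\<close> of \<open>B\<close> for an element \<open>g\<close> outside \<open>H\<close> removes this
  obstruction.  The point is that such a trade with \<open>G\<close> exists as soon as \<open>G\<close> has two elements
  outside \<open>H\<close>.  If \<open>d \<notin> G\<close> and no trade works, then every \<open>g \<in> G - H\<close> is blocked in a rigid way: its
  hyperplane \<open>L g\<close> contains all of \<open>B - {d}\<close> but one element \<open>f\<close>, and \<open>g\<close> cannot replace
  \<open>f\<close> in \<open>B\<close>.  Distinct \<open>g\<close> have distinct \<open>f\<close>, and two of them already force \<open>B - {d}\<close> and
  \<open>G\<close> to be so close that the third element of \<open>G - B\<close> can lie neither inside \<open>H\<close> nor outside.\<close>

lemma trade_outside_hyperplane:
  assumes B: "basis B" and d: "d \<in> B" and G: "basis G"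
    and H_def: "H = hyperplane (B - {d})"
    and two: "2 \<le> card (G - H)"
  obtains f g where "f \<in> B - G" "f \<noteq> d" "g \<in> G - B" "g \<notin> H"
    "basis (insert g (B - {f}))" "basis (insert f (G - {g}))"
proof -
  note found = that
  define U where "U = B - {d}"
  have nbU: "near_basis U" using near_basis_remove B d by (simp add: U_def)
  have UH: "U \<subseteq> H" using subset_hyperplane[OF nbU] by (simp add: U_def H_def)
  have dH: "d \<notin> H" using basis_not_in_own_hyperplane B d by (simp add: H_def)
  have BE: "B \<subseteq> E" and GE: "G \<subseteq> E" using basis_subset_ground B G by auto
  have finU: "finite U" using basis_finite B by (simp add: U_def)
  have finG: "finite G" using basis_finite G by simp
  have cU: "Suc (card U) = rank" using nbU by (simp add: near_basis_def)
  have outside: "g \<in> G - B" if "g \<in> G" "g \<notin> H" "g \<noteq> d" for g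
    using that UH by (auto simp: U_def)
  show thesis
  proof (cases "d \<in> G")
    case True
    \<comment> \<open>The symmetric exchange of \<open>g\<close> cannot pick \<open>d\<close>, as \<open>d\<close> is in both bases.\<close>
    have "\<not> G - H \<subseteq> {d}"
      using two card_mono[of "{d}" "G - H"] by auto
    then obtain g where g: "g \<in> G" "g \<notin> H" "g \<noteq> d" by blast
    obtain f where "f \<in> B - G" "basis (insert f (G - {g}))" "basis (insert g (B - {f}))"
      using symmetric_exchange_property[OF G B outside[OF g]] by blast
    with that True outside[OF g] g show thesis by blast
  next
    case False
    have outside': "g \<in> G - B" if "g \<in> G - H" for g
      using outside that False by auto
    define L where "L g = hyperplane (G - {g})" for g
    have nbL: "near_basis (G - {g})" if "g \<in> G" for g
      using near_basis_remove G that by blast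
    have GL: "G - {g} \<subseteq> L g" "g \<notin> L g" if "g \<in> G" for g
      using subset_hyperplane[OF nbL[OF that]] basis_not_in_own_hyperplane[OF G that]
      by (auto simp: L_def)
    have common: "L g \<inter> L g' \<subseteq> G" if g: "g \<in> G" "g' \<in> G" "g \<noteq> g'" for g g'
    proof (rule ccontr)
      assume "\<not> L g \<inter> L g' \<subseteq> G"
      then obtain x where x: "x \<in> L g" "x \<in> L g'" "x \<notin> G" by blast
      then have xE: "x \<in> E" by (simp add: L_def hyperplane_def)
      have "near_basis (insert x (G - {g} - {g'}))"
        using near_basis_exchange[OF nbL[OF g(1)] xE] x g by auto
      then have "L g = L g'"
        unfolding L_def
        using hyperplanes_eq_if_common[OF nbL[OF g(1)] nbL[OF g(2)]] x GL g
        by (auto simp: L_def)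
      with GL g show False by blast
    qed
    show thesis
    proof (rule ccontr)
      assume stuck: "\<not> thesis"
      have fail: "\<not> basis (insert g (B - {f}))"
        if f: "f \<in> U" "f \<notin> L g" and g: "g \<in> G - H" for f g
      proof
        assume "basis (insert g (B - {f}))"
        moreover have "f \<notin> G" using f g GL UH by auto
        moreover have "basis (insert f (G - {g}))"
          using f BE by (auto simp: L_def hyperplane_def U_def)
        ultimately show False
          using found[of f g] f g outside'[OF g] stuck by (auto simp: U_def)
      qed
      \<comment> \<open>In \<open>B\<close>, \<open>g\<close> can replace no element of \<open>U - L g\<close>; hence there is only one.\<close>
      have "\<exists>f. f \<in> U \<and> f \<notin> L g \<and> U - {f} \<subseteq> L g" if g: "g \<in> G - H" for g
      proof -
        have "\<not> U \<subseteq> L g"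
        proof
          assume "U \<subseteq> L g"
          then have "H = L g"
            using hyperplane_eqI[OF nbL[of g] nbU] g by (simp add: L_def H_def U_def)
          then have "G - H \<subseteq> {g}" using GL(1) g by auto
          with two card_mono[of "{g}" "G - H"] show False by auto
        qed
        then obtain f where f: "f \<in> U" "f \<notin> L g" by blast
        have "f' \<in> L g" if f': "f' \<in> U" "f' \<noteq> f" for f'
        proof (rule ccontr)
          assume "f' \<notin> L g"
          then have "\<not> basis (insert g (B - {f'}))" "\<not> basis (insert g (B - {f}))"
            using fail f f' g by auto
          then show False
            using blocked_element_unique[OF B, of f f' g] f f' g outside'[OF g] GE
            by (auto simp: U_def)
        qed
        with f show ?thesis by blast
      qed
      then obtain \<phi> where \<phi>: "\<phi> g \<in> U" "\<phi> g \<notin> L g" "U - {\<phi> g} \<subseteq> L g"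
        if "g \<in> G - H" for g
        by metis
      have \<phi>G: "\<phi> g \<notin> G" if "g \<in> G - H" for g
        using \<phi>(1,2)[OF that] GL(1)[of g] that UH by (cases "\<phi> g = g") auto
      have inj: "\<phi> g \<noteq> \<phi> g'" if g: "g \<in> G - H" "g' \<in> G - H" "g \<noteq> g'" for g g'
      proof
        assume eq: "\<phi> g = \<phi> g'"
        define f where "f = \<phi> g"
        have f: "f \<in> U" "f \<notin> L g" "f \<notin> L g'" using \<phi>(1,2)[OF g(1)] \<phi>(2)[OF g(2)] eq
        by (auto simp: f_def)
        \<comment> \<open>Now \<open>B\<close> and \<open>G\<close> differ only in \<open>d, f\<close> against \<open>g, g'\<close>, and the hyperplane of
          \<open>B - {f}\<close> swallows \<open>G\<close>.\<close>
        have sub: "U - {f} \<subseteq> G - {g} - {g'}"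
          using \<phi>(3)[OF g(1)] \<phi>(3)[OF g(2)] eq common[of g g'] g UH by (auto simp: f_def)
        have "card (U - {f}) = rank - 2" "card (G - {g} - {g'}) = rank - 2"
          using f finU cU g finG basis_card[OF G] by auto
        then have eqU: "U - {f} = G - {g} - {g'}"
          using card_seteq[OF _ sub] finG by simp
        have nbf: "near_basis (B - {f})" using near_basis_remove B f by (auto simp: U_def)
        have "g \<in> hyperplane (B - {f})" "g' \<in> hyperplane (B - {f})"
          using fail f g GE by (auto simp: hyperplane_def)
        moreover have "G \<subseteq> insert g (insert g' (B - {f}))"
          using eqU by (auto simp: U_def)
        ultimately have "G \<subseteq> hyperplane (B - {f})" using subset_hyperplane[OF nbf] by blast
        with no_basis_in_hyperplane[OF nbf] G show False by blast
      qed
      obtain g\<^sub>1 where g1: "g\<^sub>1 \<in> G - H"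
        using two by (metis all_not_in_conv card.empty not_numeral_le_zero)
      have "\<not> G - H \<subseteq> {g\<^sub>1}" using two card_mono[of "{g\<^sub>1}" "G - H"] by auto
      then obtain g\<^sub>2 where g2: "g\<^sub>2 \<in> G - H" "g\<^sub>1 \<noteq> g\<^sub>2" by blast
      define f\<^sub>1 f\<^sub>2 where "f\<^sub>1 = \<phi> g\<^sub>1" and "f\<^sub>2 = \<phi> g\<^sub>2"
      have f12: "f\<^sub>1 \<noteq> f\<^sub>2" "f\<^sub>1 \<in> U" "f\<^sub>2 \<in> U" "f\<^sub>1 \<notin> G" "f\<^sub>2 \<notin> G"
        using inj \<phi>(1) \<phi>G g1 g2 by (auto simp: f\<^sub>1_def f\<^sub>2_def)
      have sub: "U - {f\<^sub>1} - {f\<^sub>2} \<subseteq> G - {g\<^sub>1} - {g\<^sub>2}"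
        using \<phi>(3)[OF g1] \<phi>(3)[OF g2(1)] common[of g\<^sub>1 g\<^sub>2] g1 g2 UH
        by (auto simp: f\<^sub>1_def f\<^sub>2_def)
      have "card (U - {f\<^sub>1} - {f\<^sub>2}) < card (U - {f\<^sub>1})"
        using f12 finU by (intro psubset_card_mono) auto
      also have "card (U - {f\<^sub>1}) = card (G - {g\<^sub>1} - {g\<^sub>2})"
        using f12 finU cU g1 g2 finG basis_card[OF G] by auto
      finally obtain h where h: "h \<in> G" "h \<noteq> g\<^sub>1" "h \<noteq> g\<^sub>2" "h \<notin> U"
        using f12 card_mono[of "U - {f\<^sub>1} - {f\<^sub>2}" "G - {g\<^sub>1} - {g\<^sub>2}"] finU by fastforce
      show False
      proof (cases "h \<in> H")
        case False
        \<comment> \<open>A third value of \<open>\<phi>\<close> would be needed, but \<open>f\<^sub>1\<close> and \<open>f\<^sub>2\<close> are all of \<open>U - G\<close>.\<close>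
        then have "\<phi> h \<in> U - G" "\<phi> h \<noteq> f\<^sub>1" "\<phi> h \<noteq> f\<^sub>2"
          using h \<phi>(1) \<phi>G inj g1 g2 by (auto simp: f\<^sub>1_def f\<^sub>2_def)
        with sub show False by blast
      next
        case True
        have "near_basis (insert h (U - {f\<^sub>2}))"
          using near_basis_exchange[OF nbU _ h(4) f12(3)] h GE by auto
        then have "H = L g\<^sub>2"
          using hyperplanes_eq_if_common[OF nbU nbL[of g\<^sub>2]] True UH h g2 \<phi>(3)[OF g2(1)] GL(1)[of g\<^sub>2]
          by (auto simp: L_def f\<^sub>2_def H_def U_def)
        with UH f12 \<phi>(2)[OF g2(1)] show False by (auto simp: f\<^sub>2_def)
      qed
    qed
  qed
qed

text \<open>A detour through \<open>q\<close> brings \<open>d'\<close> into \<open>A\<close> at the cost of \<open>e\<close> and \<open>e'\<close>: first \<open>e\<close> is exchanged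
  for \<open>q\<close>, then \<open>e'\<close> for \<open>d'\<close>.  The obstructions themselves make the second exchange possible.
  The hyperplane of \<open>A - {e}\<close> contains \<open>d'\<close>, so \<open>d'\<close> and \<open>A - {e, e'}\<close> span it, and it misses \<open>q\<close>;
  likewise \<open>e'\<close> and \<open>B - {d', q}\<close> span the hyperplane of \<open>B - {d'}\<close>, which misses \<open>e\<close>.\<close>

lemma detour:
  assumes A: "basis A" and B: "basis B"
    and e: "e \<in> A - B" "e' \<in> A - B" "e \<noteq> e'" and d: "d \<in> B - A" "d' \<in> B - A" "d \<noteq> d'"
    and A_blocked: "\<not> basis (insert d' (A - {e}))"
    and B_blocked: "\<not> basis (insert e (B - {d}))" "\<not> basis (insert e' (B - {d'}))"
    and q: "q \<in> B - A" "q \<noteq> d" "q \<noteq> d'" "basis (insert q (A - {e}))"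
  obtains A\<^sub>1 B\<^sub>1 A\<^sub>2 B\<^sub>2 where "symmetric_exchange A B A\<^sub>1 B\<^sub>1" "symmetric_exchange A\<^sub>1 B\<^sub>1 A\<^sub>2 B\<^sub>2"
    "A\<^sub>2 = insert d' (insert q (A - {e} - {e'}))"
proof -
  have AE: "A \<subseteq> E" and BE: "B \<subseteq> E" using basis_subset_ground A B by auto
  define A\<^sub>1 where "A\<^sub>1 = insert q (A - {e})"
  define B\<^sub>1 where "B\<^sub>1 = insert e (B - {q})"
  have A1: "basis A\<^sub>1" using q by (simp add: A\<^sub>1_def)
  have B1: "basis B\<^sub>1"
    using blocked_element_unique[OF B _ _ _ _ _ B_blocked(1), of q] d q e AE by (auto simp: B\<^sub>1_def)
  have step1: "symmetric_exchange A B A\<^sub>1 B\<^sub>1"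
    unfolding A\<^sub>1_def B\<^sub>1_def
    using A B e q A1 B1 by (intro symmetric_exchangeI) (auto simp: A\<^sub>1_def B\<^sub>1_def)
  have A2: "basis (insert d' (A\<^sub>1 - {e'}))"
  proof -
    have nb: "near_basis (A - {e})" using near_basis_remove A e by blast
    have "near_basis (insert d' (A - {e} - {e'}))"
      using near_basis_exchange[OF nb] d e BE by auto
    moreover have "insert d' (A - {e} - {e'}) \<subseteq> hyperplane (A - {e})"
      using subset_hyperplane[OF nb] A_blocked d BE by (auto simp: hyperplane_def)
    ultimately have "hyperplane (insert d' (A - {e} - {e'})) = hyperplane (A - {e})"
      using hyperplane_eqI nb by blast
    moreover have "q \<notin> hyperplane (A - {e})" "q \<in> E" using q BE by (auto simp: hyperplane_def)
    ultimately have "basis (insert q (insert d' (A - {e} - {e'})))"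
      unfolding hyperplane_def by blast
    moreover have "insert q (insert d' (A - {e} - {e'})) = insert d' (A\<^sub>1 - {e'})"
      using q e by (auto simp: A\<^sub>1_def)
    ultimately show ?thesis by simp
  qed
  have B2: "basis (insert e' (B\<^sub>1 - {d'}))"
  proof -
    have nb: "near_basis (B - {d'})" using near_basis_remove B d by blast
    have "near_basis (insert e' (B - {d'} - {q}))"
      using near_basis_exchange[OF nb] q e AE by auto
    moreover have "insert e' (B - {d'} - {q}) \<subseteq> hyperplane (B - {d'})"
      using subset_hyperplane[OF nb] B_blocked(2) e AE by (auto simp: hyperplane_def)
    ultimately have "hyperplane (insert e' (B - {d'} - {q})) = hyperplane (B - {d'})"
      using hyperplane_eqI nb by blast
    moreover have "basis (insert e (B - {d'}))"
      using blocked_element_unique[OF B _ _ _ _ _ B_blocked(1), of d'] d e AE by auto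
    then have "e \<notin> hyperplane (B - {d'})" by (auto simp: hyperplane_def)
    ultimately have "basis (insert e (insert e' (B - {d'} - {q})))"
      using e AE unfolding hyperplane_def by blast
    moreover have "insert e (insert e' (B - {d'} - {q})) = insert e' (B\<^sub>1 - {d'})"
      using q e d by (auto simp: B\<^sub>1_def)
    ultimately show ?thesis by simp
  qed
  have "symmetric_exchange A\<^sub>1 B\<^sub>1 (insert d' (A\<^sub>1 - {e'})) (insert e' (B\<^sub>1 - {d'}))"
    using A1 B1 A2 B2 e d q by (intro symmetric_exchangeI) (auto simp: A\<^sub>1_def B\<^sub>1_def)
  moreover have "insert d' (A\<^sub>1 - {e'}) = insert d' (insert q (A - {e} - {e'}))"
    using e q by (auto simp: A\<^sub>1_def)
  ultimately show ?thesis using that step1 by blast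
qed

text \<open>If \<open>B - A\<close> were just \<open>{d, d'}\<close>, then the hyperplane of \<open>A - {e'}\<close> would contain \<open>B\<close>.  So there is
  a further \<open>q\<close>, and it can replace \<open>e\<close> or \<open>e'\<close> in \<open>A\<close>; these cases are symmetric.\<close>

lemma crossed_pair_exchange:
  assumes A: "basis A" and B: "basis B"
    and e: "e \<in> A - B" "e' \<in> A - B" "e \<noteq> e'" and d: "d \<in> B - A" "d' \<in> B - A" "d \<noteq> d'"
    and A_blocked: "\<not> basis (insert d' (A - {e}))" "\<not> basis (insert d (A - {e'}))"
    and B_blocked: "\<not> basis (insert e (B - {d}))" "\<not> basis (insert e' (B - {d'}))"
  obtains A\<^sub>1 B\<^sub>1 A\<^sub>2 B\<^sub>2 x where "symmetric_exchange A B A\<^sub>1 B\<^sub>1" "symmetric_exchange A\<^sub>1 B\<^sub>1 A\<^sub>2 B\<^sub>2"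
    "x \<in> {d, d'}" "insert x (A - {e, e'}) \<subseteq> A\<^sub>2"
proof -
  have AE: "A \<subseteq> E" and BE: "B \<subseteq> E" using basis_subset_ground A B by auto
  have fin: "finite A" "finite B" using basis_finite A B by auto
  have "\<not> B - A \<subseteq> {d, d'}"
  proof
    assume "B - A \<subseteq> {d, d'}"
    then have sub: "B - {d} - {d'} \<subseteq> A - {e} - {e'}" using e by auto
    have "card (A - {e} - {e'}) = card (B - {d} - {d'})"
      using e d fin basis_card[OF A] basis_card[OF B] by auto
    then have eq: "B - {d} - {d'} = A - {e} - {e'}" using card_seteq[OF _ sub] fin by simp
    have nbA: "near_basis (A - {e'})" and nbB: "near_basis (B - {d'})"
      using near_basis_remove A B e d by auto
    have "B - {d'} \<subseteq> insert d (A - {e'})" using eq by blast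
    with A_blocked(2) d BE subset_hyperplane[OF nbA] have "B - {d'} \<subseteq> hyperplane (A - {e'})"
      by (auto simp: hyperplane_def)
    moreover have "d' \<in> hyperplane (A - {e'})"
    proof -
      have nb: "near_basis (B - {d})" using near_basis_remove B d by blast
      have "A - {e'} \<subseteq> insert e (B - {d})" using eq by blast
      then have "A - {e'} \<subseteq> hyperplane (B - {d})"
        using B_blocked(1) e AE subset_hyperplane[OF nb] by (auto simp: hyperplane_def)
      then have "hyperplane (A - {e'}) = hyperplane (B - {d})"
        using hyperplane_eqI nb nbA by blast
      with subset_hyperplane[OF nb] d show ?thesis by blast
    qed
    ultimately have "B \<subseteq> hyperplane (A - {e'})" by blast
    with no_basis_in_hyperplane[OF nbA] B show False by blast
  qed
  then obtain q where q: "q \<in> B - A" "q \<noteq> d" "q \<noteq> d'" by blast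
  show thesis
  proof (cases "basis (insert q (A - {e}))")
    case True
    obtain A\<^sub>1 B\<^sub>1 A\<^sub>2 B\<^sub>2 where *: "symmetric_exchange A B A\<^sub>1 B\<^sub>1" "symmetric_exchange A\<^sub>1 B\<^sub>1 A\<^sub>2 B\<^sub>2"
      "A\<^sub>2 = insert d' (insert q (A - {e} - {e'}))"
      by (rule detour[OF A B e d A_blocked(1) B_blocked q True])
    show thesis using *(3) by (intro that[OF *(1,2), of d']) auto
  next
    case False
    then have *: "basis (insert q (A - {e'}))"
      using blocked_element_unique[OF A, of e e' q] e q BE by auto
    obtain A\<^sub>1 B\<^sub>1 A\<^sub>2 B\<^sub>2 where **: "symmetric_exchange A B A\<^sub>1 B\<^sub>1" "symmetric_exchange A\<^sub>1 B\<^sub>1 A\<^sub>2 B\<^sub>2"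
      "A\<^sub>2 = insert d (insert q (A - {e'} - {e}))"
      by (rule detour[OF A B e(2,1) e(3)[symmetric] d(2,1) d(3)[symmetric] A_blocked(2)
          B_blocked(2,1) q(1,3,2) *])
    show thesis using **(3) by (intro that[OF **(1,2), of d]) auto
  qed
qed

end

section \<open>Tuples of bases\<close>

lemma multiset_union_Cons [simp]: "multiset_union (B # Bs) = mset_set B + multiset_union Bs"
  by (simp add: multiset_union_def)

lemma multiset_union_update:
  "i < length Bs \<Longrightarrow>
    multiset_union (Bs[i := A]) + mset_set (Bs ! i) = multiset_union Bs + mset_set A"
proof (induction Bs arbitrary: i)
  case (Cons B Bs)
  then show ?case by (cases i) (auto simp: add_ac)
qed simp

lemma count_multiset_union:
  "\<forall>B \<in> set Bs. finite B \<Longrightarrow> count (multiset_union Bs) x = length (filter (\<lambda>B. x \<in> B) Bs)"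
  by (induction Bs) (auto simp: multiset_union_def)

lemma size_multiset_union_Int:
  assumes "\<forall>B \<in> set Bs. finite B"
  shows "size (filter_mset (\<lambda>x. x \<in> H) (multiset_union Bs)) = (\<Sum>B\<leftarrow>Bs. card (B \<inter> H))"
  using assms
proof (induction Bs)
  case (Cons B Bs)
  have "{x \<in> B. x \<in> H} = B \<inter> H" by blast
  with Cons show ?case by simp
qed (simp add: multiset_union_def)

lemma sum_list_lower_bound:
  fixes f :: "'b \<Rightarrow> nat"
  shows "\<forall>x \<in> set xs. k \<le> f x \<Longrightarrow> length xs * k \<le> (\<Sum>x\<leftarrow>xs. f x)"
  by (induction xs) auto

lemma sum_list_upper_bound:
  fixes f :: "'b \<Rightarrow> nat"
  shows "\<forall>x \<in> set xs. f x \<le> k \<Longrightarrow> (\<Sum>x\<leftarrow>xs. f x) \<le> length xs * k"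
  by (induction xs) auto

context matroid
begin

inductive step :: "'a set list \<Rightarrow> 'a set list \<Rightarrow> bool" where
  step: "symmetric_exchange (Bs ! i) (Bs ! j) A B \<Longrightarrow> i < length Bs \<Longrightarrow> j < length Bs \<Longrightarrow> i \<noteq> j \<Longrightarrow>
    step Bs (Bs[i := A, j := B])"

lemma symmetric_exchange_multiset:
  assumes "symmetric_exchange A B A' B'"
  shows "mset_set A' + mset_set B' = mset_set A + mset_set B"
proof -
  obtain a b where ab: "a \<in> A - B" "b \<in> B - A" "A' = (A \<union> {b}) - {a}" "B' = (B \<union> {a}) - {b}"
    and fin: "finite A" "finite B"
    using assms basis_finite unfolding symmetric_exchange_def by blast
  have "A' = insert b (A - {a})" "B' = insert a (B - {b})" using ab by blast+
  moreover have "mset_set (insert b (A - {a})) = add_mset b (mset_set (A - {a}))"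
    "mset_set (insert a (B - {b})) = add_mset a (mset_set (B - {b}))"
    using ab(1,2) fin by (simp_all add: mset_set.insert)
  moreover have "mset_set A = add_mset a (mset_set (A - {a}))"
    "mset_set B = add_mset b (mset_set (B - {b}))"
    using ab(1,2) fin by (simp_all add: mset_set.remove)
  ultimately show ?thesis by simp
qed

lemma step_multiset_union:
  assumes "step Bs Cs"
  shows "multiset_union Cs = multiset_union Bs"
  using assms
proof cases
  case (step i j A B)
  have 1: "multiset_union (Bs[i := A]) + mset_set (Bs ! i) = multiset_union Bs + mset_set A"
    using multiset_union_update step by blast
  have 2: "multiset_union Cs + mset_set (Bs ! j) = multiset_union (Bs[i := A]) + mset_set B"
    using multiset_union_update[of j "Bs[i := A]" B] step by simp
  have "multiset_union Cs + (mset_set (Bs ! i) + mset_set (Bs ! j))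
      = (multiset_union Cs + mset_set (Bs ! j)) + mset_set (Bs ! i)"
    by (simp only: add_ac)
  also have "\<dots> = (multiset_union (Bs[i := A]) + mset_set (Bs ! i)) + mset_set B"
    by (simp only: 2 add_ac)
  also have "\<dots> = multiset_union Bs + (mset_set A + mset_set B)"
    unfolding 1 by (rule add.assoc)
  finally have "multiset_union Cs + (mset_set (Bs ! i) + mset_set (Bs ! j))
      = multiset_union Bs + (mset_set A + mset_set B)" .
  with symmetric_exchange_multiset[OF step(2)] show ?thesis by simp
qed

lemma step_bases:
  assumes "step Bs Cs" "\<forall>B \<in> set Bs. basis B"
  shows "\<forall>B \<in> set Cs. basis B"
  using assms(1)
proof cases
  case (step i j A B)
  have "set Cs \<subseteq> insert B (insert A (set Bs))"
    using set_update_subset_insert[of "Bs[i := A]" j B] set_update_subset_insert[of Bs i A] step(1)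
    by blast
  with step(2) assms(2) show ?thesis unfolding symmetric_exchange_def by blast
qed

lemma step_length: "step Bs Cs \<Longrightarrow> length Cs = length Bs"
  by (auto elim: step.cases)

lemma steps_invariants:
  assumes "step\<^sup>*\<^sup>* Bs Cs"
  shows "multiset_union Cs = multiset_union Bs" "length Cs = length Bs"
    "\<forall>B \<in> set Bs. basis B \<Longrightarrow> \<forall>B \<in> set Cs. basis B"
  using assms
  by (induction rule: rtranclp_induct)
    (simp_all add: step_multiset_union step_length step_bases)

lemma step_Cons:
  assumes "step Bs Cs"
  shows "step (B # Bs) (B # Cs)"
  using assms
proof cases
  case (step i j A A')
  have "step (B # Bs) ((B # Bs)[Suc i := A, Suc j := A'])"
    using step(2-5) by (intro step.step) auto
  with step(1) show ?thesis by simp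
qed

lemma steps_Cons: "step\<^sup>*\<^sup>* Bs Cs \<Longrightarrow> step\<^sup>*\<^sup>* (B # Bs) (B # Cs)"
  by (induction rule: rtranclp_induct) (auto intro: step_Cons rtranclp.rtrancl_into_rtrancl)

lemma step_imp_exchange_step:
  assumes "step Bs Cs"
  shows "exchange_step (length Bs) Bs Cs"
  using assms
proof cases
  case (step i j A B)
  then show ?thesis
    unfolding exchange_step_def by (intro exI[of _ i] exI[of _ j] conjI) auto
qed

lemma steps_imp_exchange_sequence:
  assumes "step\<^sup>*\<^sup>* Bs Cs" "\<forall>B \<in> set Bs. basis B" "length Bs = n"
  shows "\<exists>S. exchange_sequence n S Bs Cs"
  using assms(1)
proof (induction rule: rtranclp_induct)
  case base
  have "exchange_sequence n [Bs] Bs Bs"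
    using assms unfolding exchange_sequence_def basis_tuple_def by simp
  then show ?case by blast
next
  case (step Cs Ds)
  then obtain S where S: "exchange_sequence n S Bs Cs" by blast
  have "step\<^sup>*\<^sup>* Bs Ds" using step by auto
  from steps_invariants(2,3)[OF this] assms have "basis_tuple n Ds"
    by (auto simp: basis_tuple_def)
  moreover have "exchange_step n Cs Ds"
    using step_imp_exchange_step[OF step(2)] steps_invariants(2)[OF step(1)] assms by simp
  ultimately have "exchange_sequence n (S @ [Ds]) Bs Ds"
    using S unfolding exchange_sequence_def
    by (auto simp: nth_append last_conv_nth less_Suc_eq)
  then show ?case by blast
qed

end

context paving_matroid
begin

definition can_approach :: "'a set list \<Rightarrow> 'a set \<Rightarrow> bool" where
  "can_approach Bs D \<longleftrightarrow> (\<exists>Cs. step\<^sup>*\<^sup>* Bs Cs \<and> card (Bs ! 0 \<inter> D) < card (Cs ! 0 \<inter> D))"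

lemma update_head: "i < length Bs \<Longrightarrow> Bs[0 := A] ! 0 = A"
  by (cases Bs) auto

lemma bases_head_nth:
  "\<forall>B \<in> set Bs. basis B \<Longrightarrow> i < length Bs \<Longrightarrow> basis (Bs ! 0) \<and> basis (Bs ! i)"
  by (metis le_less_trans nth_mem zero_le)

lemma can_approach_steps:
  "step\<^sup>*\<^sup>* Bs Cs \<Longrightarrow> Cs ! 0 = Bs ! 0 \<Longrightarrow> can_approach Cs D \<Longrightarrow> can_approach Bs D"
  unfolding can_approach_def by (metis rtranclp_trans)

lemma can_approachI:
  assumes "step\<^sup>*\<^sup>* Bs Cs" "Bs ! 0 \<inter> D \<subset> Cs ! 0 \<inter> D" "basis D"
  shows "can_approach Bs D"
  unfolding can_approach_def using assms basis_finite
  by (intro exI[of _ Cs] conjI psubset_card_mono) auto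

lemma can_approach_by_exchange:
  assumes bases: "\<forall>B \<in> set Bs. basis B" and D: "basis D" and i: "0 < i" "i < length Bs"
    and e: "e \<in> Bs ! 0 - D" "e \<notin> Bs ! i" and d: "d \<in> D - Bs ! 0" "d \<in> Bs ! i"
    and ex: "basis (insert d (Bs ! 0 - {e}))" "basis (insert e (Bs ! i - {d}))"
  shows "can_approach Bs D"
proof -
  let ?Cs = "Bs[0 := insert d (Bs ! 0 - {e}), i := insert e (Bs ! i - {d})]"
  have "basis (Bs ! 0)" "basis (Bs ! i)" using bases_head_nth bases i by auto
  then have "symmetric_exchange (Bs ! 0) (Bs ! i) (insert d (Bs ! 0 - {e})) (insert e (Bs ! i - {d}))"
    using e d ex by (intro symmetric_exchangeI) auto
  then have "step Bs ?Cs" using i by (intro step.step) auto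
  moreover have "?Cs ! 0 = insert d (Bs ! 0 - {e})" using i by (simp add: update_head)
  then have "Bs ! 0 \<inter> D \<subset> ?Cs ! 0 \<inter> D" using e d by blast
  ultimately show ?thesis using can_approachI[of Bs ?Cs D] D by blast
qed

lemma step_away_from_head:
  assumes bases: "\<forall>B \<in> set Bs. basis B" and ij: "0 < i" "0 < j" "i < length Bs" "j < length Bs" "i \<noteq> j"
    and f: "f \<in> Bs ! i - Bs ! j" and g: "g \<in> Bs ! j - Bs ! i"
    and ex: "basis (insert g (Bs ! i - {f}))" "basis (insert f (Bs ! j - {g}))"
  obtains Cs where "step\<^sup>*\<^sup>* Bs Cs" "Cs ! 0 = Bs ! 0" "Cs ! i = insert g (Bs ! i - {f})"
proof -
  let ?Cs = "Bs[i := insert g (Bs ! i - {f}), j := insert f (Bs ! j - {g})]"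
  have "basis (Bs ! i)" "basis (Bs ! j)" using bases ij by auto
  then have "symmetric_exchange (Bs ! i) (Bs ! j) (insert g (Bs ! i - {f})) (insert f (Bs ! j - {g}))"
    using f g ex by (intro symmetric_exchangeI) auto
  then have "step Bs ?Cs" using ij by (intro step.step) auto
  with that[of ?Cs] ij show thesis by (auto simp: nth_list_update)
qed

text \<open>Trading \<open>f \<noteq> d\<close> in \<open>Bs ! i\<close> for \<open>g \<notin> H\<close> lets \<open>e\<close> replace \<open>d\<close>: the result has \<open>g\<close> as its only
  element outside \<open>H\<close>, and the other ones span \<open>H\<close>.\<close>

lemma can_approach_if_trade:
  assumes bases: "\<forall>B \<in> set Bs. basis B" and D: "basis D" and i: "0 < i" "i < length Bs"
    and e: "e \<in> Bs ! 0 - D" "e \<notin> Bs ! i" and d: "d \<in> D - Bs ! 0" "d \<in> Bs ! i"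
    and ex: "basis (insert d (Bs ! 0 - {e}))"
    and H_def: "H = hyperplane (Bs ! i - {d})" and eH: "e \<in> H"
    and j: "0 < j" "j < length Bs" "2 \<le> card (Bs ! j - H)"
  shows "can_approach Bs D"
proof -
  have B: "basis (Bs ! i)" "basis (Bs ! j)" "basis (Bs ! 0)"
    using bases_head_nth bases i j by auto
  have nb: "near_basis (Bs ! i - {d})" using near_basis_remove B d by blast
  have ij: "i \<noteq> j"
  proof
    assume "i = j"
    then have "Bs ! j - H \<subseteq> {d}" using subset_hyperplane[OF nb] by (auto simp: H_def)
    from card_mono[OF _ this] j(3) show False by simp
  qed
  obtain f g where fg: "f \<in> Bs ! i - Bs ! j" "f \<noteq> d" "g \<in> Bs ! j - Bs ! i" "g \<notin> H"
    and swap: "basis (insert g (Bs ! i - {f}))" "basis (insert f (Bs ! j - {g}))"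
    by (rule trade_outside_hyperplane[OF B(1) d(2) B(2) H_def j(3)])
  obtain Cs where Cs: "step\<^sup>*\<^sup>* Bs Cs" "Cs ! 0 = Bs ! 0" "Cs ! i = insert g (Bs ! i - {f})"
    by (rule step_away_from_head[OF bases i(1) j(1) i(2) j(2) ij fg(1,3) swap])
  have eE: "e \<in> E" using e B basis_subset_ground by blast
  have gE: "g \<in> E" using fg B basis_subset_ground by blast
  have eg: "e \<noteq> g" using eH fg by blast
  have "near_basis (insert e (Bs ! i - {d} - {f}))"
    using near_basis_exchange[OF nb eE] e fg by auto
  moreover have "insert e (Bs ! i - {d} - {f}) \<subseteq> H"
    using subset_hyperplane[OF nb] eH by (auto simp: H_def)
  ultimately have "hyperplane (insert e (Bs ! i - {d} - {f})) = H"
    using hyperplane_eqI[OF nb] by (simp add: H_def)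
  then have "basis (insert g (insert e (Bs ! i - {d} - {f})))"
    using fg gE by (auto simp: hyperplane_def)
  moreover have "insert g (insert e (Bs ! i - {d} - {f})) = insert e (Cs ! i - {d})"
    using fg d Cs(3) by auto
  ultimately have "basis (insert e (Cs ! i - {d}))" by simp
  then have "can_approach Cs D"
    using steps_invariants(2,3)[OF Cs(1)] bases D i e d ex Cs fg eg
    by (intro can_approach_by_exchange[of Cs D i e d]) auto
  with can_approach_steps Cs show ?thesis by blast
qed

text \<open>Counted with multiplicity, both tuples meet \<open>H\<close> equally often.  No basis meets \<open>H\<close> in
  more than \<open>rank - 1\<close> elements, and the members of the tail \<open>Bs\<close> attain this bound.\<close>

lemma head_meets_hyperplane_le:
  assumes B: "\<forall>X \<in> set (B # Bs). basis X" and D: "\<forall>X \<in> set (D # Ds). basis X"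
    and mu: "multiset_union (B # Bs) = multiset_union (D # Ds)" and len: "length Bs = length Ds"
    and U: "near_basis U" and H_def: "H = hyperplane U"
    and full: "\<forall>X \<in> set Bs. card (X - H) \<le> 1"
  shows "card (B \<inter> H) \<le> card (D \<inter> H)"
proof -
  have split: "card (X \<inter> H) + card (X - H) = rank" if "basis X" for X
    using card_Int_Diff[of X H] basis_card[OF that] basis_finite[OF that] by simp
  have "rank - 1 \<le> card (X \<inter> H)" if "X \<in> set Bs" for X
    using split[of X] full B that by fastforce
  then have 1: "length Bs * (rank - 1) \<le> (\<Sum>X\<leftarrow>Bs. card (X \<inter> H))"
    by (intro sum_list_lower_bound) blast
  have "card (X \<inter> H) \<le> rank - 1" if X: "X \<in> set Ds" for X
  proof -
    have bX: "basis X" using D X by simp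
    then have "\<not> X \<subseteq> H" using no_basis_in_hyperplane[OF U] by (auto simp: H_def)
    then have "X - H \<noteq> {}" by blast
    then have "0 < card (X - H)" using basis_finite[OF bX] by (simp add: card_gt_0_iff)
    with split[OF bX] show ?thesis by linarith
  qed
  then have 2: "(\<Sum>X\<leftarrow>Ds. card (X \<inter> H)) \<le> length Ds * (rank - 1)"
    by (intro sum_list_upper_bound) blast
  have "\<forall>X \<in> set (B # Bs). finite X" "\<forall>X \<in> set (D # Ds). finite X"
    using B D basis_finite by blast+
  then have "(\<Sum>X\<leftarrow>B # Bs. card (X \<inter> H)) = (\<Sum>X\<leftarrow>D # Ds. card (X \<inter> H))"
    using mu size_multiset_union_Int by metis
  with 1 2 len show ?thesis by simp
qed

lemma element_occurs_beyond_head: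
  assumes bases: "\<forall>B \<in> set Bs. basis B" "\<forall>B \<in> set Ds. basis B" and ne: "Ds \<noteq> []"
    and mu: "multiset_union Bs = multiset_union Ds" and x: "x \<in> Ds ! 0 - Bs ! 0"
  obtains i where "0 < i" "i < length Bs" "x \<in> Bs ! i"
proof -
  have fin: "\<forall>B \<in> set Bs. finite B" "\<forall>B \<in> set Ds. finite B" using bases basis_finite by auto
  have "filter (\<lambda>B. x \<in> B) Ds \<noteq> []"
    using x ne by (auto simp: filter_empty_conv intro!: bexI[of _ "Ds ! 0"])
  then have "filter (\<lambda>B. x \<in> B) Bs \<noteq> []"
    using count_multiset_union fin mu by (metis length_0_conv)
  then obtain i where "i < length Bs" "x \<in> Bs ! i"
    by (auto simp: filter_empty_conv in_set_conv_nth)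
  with x that[of i] show thesis by (auto intro: gr0I)
qed

lemma element_missing_beyond_head:
  assumes bases: "\<forall>B \<in> set Bs. basis B" "\<forall>B \<in> set Ds. basis B"
    and len: "length Bs = length Ds" "Ds \<noteq> []"
    and mu: "multiset_union Bs = multiset_union Ds" and x: "x \<in> Bs ! 0 - Ds ! 0"
  obtains i where "0 < i" "i < length Bs" "x \<notin> Bs ! i"
proof -
  have fin: "\<forall>B \<in> set Bs. finite B" "\<forall>B \<in> set Ds. finite B" using bases basis_finite by auto
  have "length (filter (\<lambda>B. x \<in> B) Ds) < length Ds"
    using x len by (intro length_filter_less[of "Ds ! 0"]) auto
  then have "length (filter (\<lambda>B. x \<in> B) Bs) < length Bs"
    using count_multiset_union[of Bs x] count_multiset_union[of Ds x] fin mu len by simp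
  then have "\<not> (\<forall>B \<in> set Bs. x \<in> B)" by (metis filter_True less_irrefl)
  then obtain i where i: "i < length Bs" "x \<notin> Bs ! i" by (auto simp: in_set_conv_nth)
  moreover have "i \<noteq> 0" using i x by (cases i) auto
  ultimately show thesis using that[of i] by simp
qed

text \<open>The critical case is that \<open>H\<close>, the hyperplane of \<open>Bs ! i - {d}\<close>, contains \<open>e\<close> and that no
  trade helps, because each member after the head has at most one element outside \<open>H\<close>.  Then the
  target head \<open>D\<close> meets \<open>H\<close> in at least as many elements as the head \<open>A\<close>.  As \<open>e \<in> A - D\<close> is in
  \<open>H\<close>, there must be \<open>d' \<in> D - A\<close> in \<open>H\<close>; as \<open>d \<in> D - A\<close> is not, there must be \<open>e' \<in> A - D\<close> outside
  \<open>H\<close>.  Once \<open>d'\<close> is in the same member as \<open>d\<close>, either one of the exchanges of \<open>e\<close>, \<open>e'\<close> for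
  \<open>d\<close>, \<open>d'\<close> is possible or they are blocked crosswise.\<close>

lemma can_approach_if_separated:
  assumes bases: "\<forall>B \<in> set Bs. basis B" "\<forall>B \<in> set Ds. basis B"
    and len: "length Bs = length Ds" and mu: "multiset_union Bs = multiset_union Ds"
    and i: "0 < i" "i < length Bs"
    and e: "e \<in> Bs ! 0 - Ds ! 0" "e \<notin> Bs ! i" and d: "d \<in> Ds ! 0 - Bs ! 0" "d \<in> Bs ! i"
    and ex: "basis (insert d (Bs ! 0 - {e}))"
  shows "can_approach Bs (Ds ! 0)"
proof -
  define A where "A = Bs ! 0"
  define D where "D = Ds ! 0"
  have A: "basis A" and D: "basis D" and Bi: "basis (Bs ! i)"
    using bases_head_nth[of Bs i] bases_head_nth[of Ds i] bases len i by (auto simp: A_def D_def)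
  have AE: "A \<subseteq> E" and DE: "D \<subseteq> E" using basis_subset_ground A D by auto
  have finA: "finite A" and finD: "finite D" using basis_finite A D by auto
  have eA: "e \<in> A - D" "d \<in> D - A" using e d by (auto simp: A_def D_def)
  define U where "U = Bs ! i - {d}"
  define H where "H = hyperplane U"
  have U: "near_basis U" using near_basis_remove Bi d by (simp add: U_def)
  have UH: "U \<subseteq> H" using subset_hyperplane[OF U] by (simp add: H_def)
  have dH: "d \<notin> H" using basis_not_in_own_hyperplane Bi d by (simp add: H_def U_def)
  show ?thesis
  proof (cases "basis (insert e (Bs ! i - {d}))")
    case True
    then show ?thesis
      using can_approach_by_exchange[OF bases(1) D i, of e d] e d ex by (simp add: D_def)
  next
    case e_blocked: False
    have eH: "e \<in> H" using e_blocked eA AE by (auto simp: H_def U_def hyperplane_def)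
    show ?thesis
    proof (cases "\<exists>j. 0 < j \<and> j < length Bs \<and> 2 \<le> card (Bs ! j - H)")
      case True
      then show ?thesis
        using can_approach_if_trade[OF bases(1) D i, of e d H] e d ex eH
        by (auto simp: D_def H_def U_def)
    next
      case False
      obtain Bt Dt where cons: "Bs = A # Bt" "Ds = D # Dt"
        using i len by (cases Bs; cases Ds) (auto simp: A_def D_def)
      have "\<forall>X \<in> set Bt. card (X - H) \<le> 1"
      proof
        fix X assume "X \<in> set Bt"
        then obtain j where "j < length Bt" "X = Bt ! j" by (auto simp: in_set_conv_nth)
        then have "0 < Suc j" "Suc j < length Bs" "X = Bs ! Suc j" using cons by auto
        with False show "card (X - H) \<le> 1" by (metis One_nat_def Suc_1 not_less_eq_eq)
      qed
      then have le: "card (A \<inter> H) \<le> card (D \<inter> H)"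
        using head_meets_hyperplane_le[of A Bt D Dt U H] bases mu len cons U H_def by simp
      obtain d' where d': "d' \<in> D - A" "d' \<in> H"
      proof (rule ccontr)
        assume "\<not> thesis"
        then have "D \<inter> H \<subset> A \<inter> H" using that eH eA by blast
        with le finA show False using psubset_card_mono[of "A \<inter> H" "D \<inter> H"] by simp
      qed
      obtain e' where e': "e' \<in> A - D" "e' \<notin> H"
      proof (rule ccontr)
        assume "\<not> thesis"
        then have "A - H \<subset> D - H" using that dH eA by blast
        then have "card (A - H) < card (D - H)" using finD by (intro psubset_card_mono) auto
        with le show False
          using card_Int_Diff[OF finA, of H] card_Int_Diff[OF finD, of H]
            basis_card[OF A] basis_card[OF D] by simp
      qed
      obtain Cs where Cs: "step\<^sup>*\<^sup>* Bs Cs" "Cs ! 0 = A" "d \<in> Cs ! i" "d' \<in> Cs ! i"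
        "Cs ! i - {d} \<subseteq> H" "e \<notin> Cs ! i"
      proof (cases "d' \<in> Bs ! i")
        case True
        with that[of Bs] d e UH show thesis by (auto simp: A_def U_def)
      next
        case False
        have "Ds \<noteq> []" using cons(2) by blast
        moreover have "d' \<in> Ds ! 0 - Bs ! 0" using d'(1) by (simp add: A_def D_def)
        ultimately obtain j where j: "0 < j" "j < length Bs" "d' \<in> Bs ! j"
          using element_occurs_beyond_head[OF bases _ mu] by blast
        have Bj: "basis (Bs ! j)" using bases j by auto
        have d'j: "d' \<in> Bs ! j - Bs ! i" and ij: "i \<noteq> j" using False j by auto
        obtain f where f: "f \<in> Bs ! i - Bs ! j" "basis (insert f (Bs ! j - {d'}))"
          "basis (insert d' (Bs ! i - {f}))"
          using symmetric_exchange_property[OF Bj Bi d'j] by blast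
        have "f \<noteq> d"
        proof
          assume "f = d"
          then have "insert d' (Bs ! i - {f}) \<subseteq> hyperplane U"
            using UH d' by (auto simp: U_def H_def)
          with no_basis_in_hyperplane[OF U] f(3) show False by blast
        qed
        moreover obtain Cs where
          "step\<^sup>*\<^sup>* Bs Cs" "Cs ! 0 = Bs ! 0" "Cs ! i = insert d' (Bs ! i - {f})"
          by (rule step_away_from_head[OF bases(1) i(1) j(1) i(2) j(2) ij f(1) d'j f(3,2)])
        moreover from this have "Cs ! i - {d} \<subseteq> H" "e \<notin> Cs ! i"
          using UH d' eA e by (auto simp: U_def)
        ultimately show thesis using that[of Cs] d by (simp add: A_def)
      qed
      define B where "B = Cs ! i"
      have i': "0 < i" "i < length Cs" using i steps_invariants(2)[OF Cs(1)] by auto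
      have basesC: "\<forall>X \<in> set Cs. basis X" using steps_invariants(3)[OF Cs(1)] bases by blast
      have B: "basis B" using basesC i' by (simp add: B_def)
      have BE: "B \<subseteq> E" using basis_subset_ground B by blast
      have ee': "e \<noteq> e'" "d \<noteq> d'" using eH e' dH d' by auto
      have eB: "e \<in> A - B" "e' \<in> A - B" "d \<in> B - A" "d' \<in> B - A"
        using Cs e' eA d' by (auto simp: B_def)
      have nbB: "near_basis (B - {d})" using near_basis_remove B eB by blast
      have HB: "hyperplane (B - {d}) = H"
        using hyperplane_eqI[OF U nbB] Cs(5) by (simp add: H_def B_def)
      have e_blocked': "\<not> basis (insert e (B - {d}))" using eH HB by (auto simp: hyperplane_def)
      have e'_free: "basis (insert e' (B - {d}))"
        using e' HB AE by (auto simp: hyperplane_def)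
      have e_free: "basis (insert e (B - {d'}))"
        using blocked_element_unique[OF B _ _ _ _ _ e_blocked', of d'] eB ee' AE by auto
      have approach: "can_approach Cs D"
        if "x \<in> {e, e'}" "y \<in> {d, d'}" "basis (insert y (A - {x}))" "basis (insert x (B - {y}))"
        for x y
        using that can_approach_by_exchange[OF basesC D i', of x y] eA e' d' eB Cs(2)
        by (auto simp: B_def)
      have "can_approach Cs D"
      proof (rule ccontr)
        assume no: "\<not> can_approach Cs D"
        have A_blocked: "\<not> basis (insert d' (A - {e}))" using approach[of e d'] no e_free by blast
        then have "basis (insert d' (A - {e'}))"
          using blocked_element_unique[OF A, of e e' d'] eB ee' BE by auto
        then have e'_blocked: "\<not> basis (insert e' (B - {d'}))" using approach[of e' d'] no by blast
        have A_blocked': "\<not> basis (insert d (A - {e'}))" using approach[of e' d] no e'_free by blast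
        obtain A\<^sub>1 B\<^sub>1 A\<^sub>2 B\<^sub>2 x where sx: "symmetric_exchange A B A\<^sub>1 B\<^sub>1"
          "symmetric_exchange A\<^sub>1 B\<^sub>1 A\<^sub>2 B\<^sub>2" and x: "x \<in> {d, d'}" "insert x (A - {e, e'}) \<subseteq> A\<^sub>2"
          by (rule crossed_pair_exchange[OF A B eB(1,2) ee'(1) eB(3,4) ee'(2)
                A_blocked A_blocked' e_blocked' e'_blocked])
        let ?C1 = "Cs[0 := A\<^sub>1, i := B\<^sub>1]"
        let ?C2 = "?C1[0 := A\<^sub>2, i := B\<^sub>2]"
        have "step Cs ?C1" using sx(1) i' Cs(2) by (intro step.step) (auto simp: B_def)
        moreover have "step ?C1 ?C2"
          using sx(2) i' by (intro step.step) (auto simp: update_head)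
        ultimately have "step\<^sup>*\<^sup>* Cs ?C2" by auto
        moreover have "?C2 ! 0 = A\<^sub>2" using i' by (simp add: update_head)
        then have "Cs ! 0 \<inter> D \<subset> ?C2 ! 0 \<inter> D"
          using x eA e' d' Cs(2) by auto
        ultimately have "can_approach Cs D" using D by (intro can_approachI) auto
        with no show False by blast
      qed
      with can_approach_steps[OF Cs(1)] Cs(2) show ?thesis by (simp add: A_def D_def)
    qed
  qed
qed

lemma can_approach_head:
  assumes bases: "\<forall>B \<in> set Bs. basis B" "\<forall>B \<in> set Ds. basis B"
    and len: "length Bs = length Ds" "Ds \<noteq> []"
    and mu: "multiset_union Bs = multiset_union Ds" and ne: "Bs ! 0 \<noteq> Ds ! 0"
  shows "can_approach Bs (Ds ! 0)"
proof -
  have A: "basis (Bs ! 0)" and D: "basis (Ds ! 0)" using bases len by auto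
  have "\<not> Ds ! 0 \<subseteq> Bs ! 0"
    using card_seteq[OF basis_finite[OF A], of "Ds ! 0"] basis_card[OF A] basis_card[OF D] ne
    by auto
  then obtain d where d: "d \<in> Ds ! 0 - Bs ! 0" by blast
  obtain e where e: "e \<in> Bs ! 0 - Ds ! 0" "basis (insert d (Bs ! 0 - {e}))"
    using basis_exchange_into[OF A D d] by blast
  obtain k where k: "0 < k" "k < length Bs" "d \<in> Bs ! k"
    using element_occurs_beyond_head[OF bases len(2) mu d] by blast
  obtain l where l: "0 < l" "l < length Bs" "e \<notin> Bs ! l"
    using element_missing_beyond_head[OF bases len mu e(1)] by blast
  \<comment> \<open>Since \<open>Bs ! k\<close> may contain \<open>e\<close>, \<open>d\<close> is moved to \<open>Bs ! l\<close>.\<close>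
  obtain Cs where Cs: "step\<^sup>*\<^sup>* Bs Cs" "Cs ! 0 = Bs ! 0" "d \<in> Cs ! l" "e \<notin> Cs ! l"
  proof (cases "d \<in> Bs ! l")
    case True
    with that[of Bs] l show thesis by simp
  next
    case False
    have b: "basis (Bs ! k)" "basis (Bs ! l)" using bases k l by auto
    have dk: "d \<in> Bs ! k - Bs ! l" and lk: "l \<noteq> k" using False k by auto
    obtain f where f: "f \<in> Bs ! l - Bs ! k" "basis (insert f (Bs ! k - {d}))"
      "basis (insert d (Bs ! l - {f}))"
      using symmetric_exchange_property[OF b dk] by blast
    obtain Cs where "step\<^sup>*\<^sup>* Bs Cs" "Cs ! 0 = Bs ! 0" "Cs ! l = insert d (Bs ! l - {f})"
      by (rule step_away_from_head[OF bases(1) l(1) k(1) l(2) k(2) lk f(1) dk f(3,2)])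
    with that[of Cs] l d e show thesis by auto
  qed
  have "can_approach Cs (Ds ! 0)"
    using can_approach_if_separated[of Cs Ds l e d] steps_invariants[OF Cs(1)] bases len mu l Cs d e
    by simp
  with can_approach_steps Cs show ?thesis by blast
qed

text \<open>Among the tuples reachable from \<open>Bs\<close>, one whose head meets the head of \<open>Ds\<close> in as many
  elements as possible has the same head as \<open>Ds\<close>; the tails are treated by induction.\<close>

theorem steps_between_compatible_tuples:
  assumes "\<forall>B \<in> set Bs. basis B" "\<forall>B \<in> set Ds. basis B" "length Bs = length Ds"
    "multiset_union Bs = multiset_union Ds"
  shows "step\<^sup>*\<^sup>* Bs Ds"
  using assms
proof (induction Ds arbitrary: Bs)
  case (Cons D Ds)
  have D: "basis D" using Cons.prems by simp
  have "\<exists>Cs. step\<^sup>*\<^sup>* Bs Cs \<and> (\<forall>Cs'. step\<^sup>*\<^sup>* Bs Cs' \<longrightarrow> card (Cs' ! 0 \<inter> D) \<le> card (Cs ! 0 \<inter> D))"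
    by (rule ex_has_greatest_nat[of _ Bs _ "Suc (card D)"])
      (use basis_finite[OF D] in \<open>auto simp: less_Suc_eq_le intro: card_mono\<close>)
  then obtain Cs where Cs: "step\<^sup>*\<^sup>* Bs Cs"
    and max: "\<And>Cs'. step\<^sup>*\<^sup>* Bs Cs' \<Longrightarrow> card (Cs' ! 0 \<inter> D) \<le> card (Cs ! 0 \<inter> D)" by blast
  have inv: "\<forall>B \<in> set Cs. basis B" "length Cs = length (D # Ds)"
    "multiset_union Cs = multiset_union (D # Ds)"
    using steps_invariants[OF Cs] Cons.prems by auto
  have "Cs ! 0 = D"
  proof (rule ccontr)
    assume "Cs ! 0 \<noteq> D"
    then have "can_approach Cs D" using can_approach_head[OF inv(1) Cons.prems(2) inv(2) _ inv(3)] by simp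
    then obtain Cs' where "step\<^sup>*\<^sup>* Cs Cs'" "card (Cs ! 0 \<inter> D) < card (Cs' ! 0 \<inter> D)"
      unfolding can_approach_def by blast
    with max[of Cs'] Cs show False by (meson not_le rtranclp_trans)
  qed
  then obtain Ct where Ct: "Cs = D # Ct" using inv(2) by (cases Cs) auto
  then have "step\<^sup>*\<^sup>* Ct Ds" using Cons.IH[of Ct] Cons.prems inv by simp
  with Cs Ct show ?case using steps_Cons by (metis rtranclp_trans)
qed simp

end

theorem theorem1p5:
  fixes E :: "'a set" and indep :: "'a set \<Rightarrow> bool"
  assumes "matroid E indep"
    and "matroid.paving E indep"
  shows "\<forall>n::nat. 0 < n \<longrightarrow>
    (\<forall>Bs Bs'. matroid.basis_tuple indep n Bs \<and> matroid.basis_tuple indep n Bs' \<and>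
       multiset_union Bs = multiset_union Bs' \<longrightarrow>
       (\<exists>S. matroid.exchange_sequence indep n S Bs Bs'))"
proof -
  interpret paving_matroid E indep
    using assms by (simp add: paving_matroid_def paving_matroid_axioms_def)
  show ?thesis
    using steps_between_compatible_tuples steps_imp_exchange_sequence
    by (simp add: basis_tuple_def all_set_conv_all_nth)
qed

end
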